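(* Let $d$ be an integer and $c>0$ an integer with $\gcd(d,c)=1$. (1) Suppose $c+d$ is odd, and let $\frac{d}{c}=\llbracket 2c_0;2c_1,\dots,2c_n\rrbracket$ with $n \ge 0$, $c_0\in\mathbf{Z}$ and $c_1,\dots,c_n$ non-zero integers. Then $$S(d,c)=-\sum_{k=1}^n \mathrm{sign}(c_k).$$ (2) Suppose $d$ is odd, and let $\frac{d}{c}=[2a_0;a_1,2a_2,a_3,\dots,2a_{n-1},a_n]$ with $n\ge 1$ odd (entries with even index $k$ are $2a_k$, entries with odd index $k$ are $a_k$), $a_0\in\mathbf{Z}$ and $a_1,\dots,a_n$ non-zero integers such that $|a_k|>1$ for $k=1,3,\dots,n-2$. Then $$S_4(d,c)=(a_1+a_3+\dots+a_n)+\sum_{k=1}^n(-1)^k\,\mathrm{sign}(a_k).$$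
   Context: For coprime integers $d,c$ with $c>0$ the Hardy sums are $$S(d,c)=\sum_{k=1}^{c-1}(-1)^{k+1+\lfloor dk/c\rfloor},\qquad S_4(d,c)=\sum_{k=1}^{c-1}(-1)^{\lfloor dk/c\rfloor}.$$ Continued fractions (partial quotients may be negative): $$[b_0;b_1,\dots,b_n]=b_0+\cfrac{1}{b_1+\cfrac{1}{\cdots+\cfrac{1}{b_n}}},\qquad \llbracket b_0;b_1,\dots,b_n\rrbracket=b_0-\cfrac{1}{b_1-\cfrac{1}{\cdots-\cfrac{1}{b_n}}}.$$ $\mathrm{sign}(x)=1$ for $x>0$ and $-1$ for $x<0$. *)

theory Defs
  imports Complex_Main
begin

text \<open>
  Both Hardy sums are real-valued so that \<open>-1\<close> can be raised to the integer exponents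
  occurring in them, which may be negative when \<open>d\<close> is negative.
\<close>

definition hardy_S :: "int \<Rightarrow> int \<Rightarrow> real" where
  "hardy_S d c = (\<Sum>k = 1..c - 1. (-1) powi (k + 1 + \<lfloor>real_of_int (d * k) / real_of_int c\<rfloor>))"

definition hardy_S4 :: "int \<Rightarrow> int \<Rightarrow> real" where
  "hardy_S4 d c = (\<Sum>k = 1..c - 1. (-1) powi \<lfloor>real_of_int (d * k) / real_of_int c\<rfloor>)"

text \<open>
  A list \<open>[b\<^sub>0, b\<^sub>1, \<dots>, b\<^sub>n]\<close> of partial quotients is evaluated to
  \<open>b\<^sub>0 + 1/(b\<^sub>1 + 1/(\<dots> + 1/b\<^sub>n))\<close> by \<open>cf_plus\<close> and to
  \<open>b\<^sub>0 - 1/(b\<^sub>1 - 1/(\<dots> - 1/b\<^sub>n))\<close> by \<open>cf_minus\<close>. The value at the empty list is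
  arbitrary. With arbitrary integer entries a denominator can vanish, in which case the
  convention \<open>x / 0 = 0\<close> applies. This does not happen if the entries after \<open>b\<^sub>0\<close> are nonzero
  and all of them except possibly \<open>b\<^sub>n\<close> have absolute value at least \<open>2\<close>: then every
  denominator has absolute value at least \<open>1\<close>.
\<close>

fun cf_plus :: "int list \<Rightarrow> real" where
  "cf_plus [] = 0"
| "cf_plus [b] = of_int b"
| "cf_plus (b # b' # bs) = of_int b + 1 / cf_plus (b' # bs)"

fun cf_minus :: "int list \<Rightarrow> real" where
  "cf_minus [] = 0"
| "cf_minus [b] = of_int b"
| "cf_minus (b # b' # bs) = of_int b - 1 / cf_minus (b' # bs)"

end

theory Submission
  imports Defs
begin

text \<open>
  For coprime \<open>c, d > 0\<close> list the \<open>c + d - 2\<close> fractions \<open>k/c\<close> and \<open>j/d\<close> in \<open>(0, 1)\<close> in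
  increasing order. The rank of \<open>k/c\<close> is \<open>k + \<lfloor>dk/c\<rfloor>\<close> and that of \<open>j/d\<close> is \<open>j + \<lfloor>cj/d\<rfloor>\<close>, so
  \<open>S(d,c) + S(c,d)\<close> is an alternating sum over all ranks; it equals \<open>1\<close> if \<open>c + d\<close> is odd. As \<open>S(d,c)\<close>
  is odd and \<open>2c\<close>-periodic in \<open>d\<close>, removing the first partial quotient of \<open>d/c\<close> changes \<open>S\<close> by
  \<open>sign(c\<^sub>1)\<close>.

  For odd \<open>d > 0\<close>, exchanging the order of summation gives \<open>S\<^sub>4(d,c) = E(c,d) - 1\<close> with
  \<open>E(c,d) = c - 2 \<Sum>\<^sub>j (-1)\<^sup>j \<lfloor>cj/d\<rfloor>\<close>, where \<open>0 < j < d\<close>. Unlike \<open>S\<^sub>4\<close>, \<open>E\<close> makes sense for all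
  integers \<open>c\<close>; it is odd in \<open>c\<close> and satisfies \<open>E(c + ad, d) = E(c,d) + a\<close>. This determines how
  \<open>S\<^sub>4\<close> changes when the first two partial quotients are removed.
\<close>

subsection \<open>Symmetries\<close>

lemma powi_minus_one: "(-1 :: real) powi i = (if even i then 1 else -1)"
  by (simp add: power_int_minus_left)

lemma hardy_S_div: "hardy_S d c = (\<Sum>k = 1..c - 1. (-1) powi (k + 1 + d * k div c))"
  by (simp only: hardy_S_def floor_divide_of_int_eq)

lemma hardy_S4_div: "hardy_S4 d c = (\<Sum>k = 1..c - 1. (-1) powi (d * k div c))"
  by (simp only: hardy_S4_def floor_divide_of_int_eq)

lemma not_dvd_mult_of_coprime:
  fixes c d k :: int
  assumes "coprime d c" "k \<in> {1..c - 1}"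
  shows "\<not> c dvd d * k"
proof
  assume "c dvd d * k"
  then have "c dvd k"
    using assms(1) by (simp add: coprime_commute coprime_dvd_mult_right_iff)
  then show False using assms(2) zdvd_imp_le[of c k] by auto
qed

lemma minus_div_of_not_dvd:
  fixes m c :: int
  assumes "c > 0" "\<not> c dvd m"
  shows "(- m) div c = - (m div c) - 1"
  using assms by (auto simp: zdiv_zminus1_eq_if dvd_eq_mod_eq_0)

text \<open>\<open>d * k / c\<close> is not an integer here, so negation turns the floor
  \<open>m\<close> into \<open>- m - 1\<close>, which has the opposite parity. This makes both Hardy
  sums odd in \<open>d\<close>.\<close>

lemma minus_mult_div:
  fixes c d k :: int
  assumes "coprime d c" "k \<in> {1..c - 1}"
  shows "(- d) * k div c = - (d * k div c) - 1"
  using minus_div_of_not_dvd[OF _ not_dvd_mult_of_coprime[OF assms]] assms(2) by simp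

lemma hardy_S_minus:
  assumes "coprime d c"
  shows "hardy_S (- d) c = - hardy_S d c"
  unfolding hardy_S_div sum_negf[symmetric]
  by (intro sum.cong refl) (auto simp: powi_minus_one minus_mult_div[OF assms] simp del: mult_minus_left)

lemma hardy_S4_minus:
  assumes "coprime d c"
  shows "hardy_S4 (- d) c = - hardy_S4 d c"
  unfolding hardy_S4_div sum_negf[symmetric]
  by (intro sum.cong refl) (auto simp: powi_minus_one minus_mult_div[OF assms] simp del: mult_minus_left)

lemma div_add_period:
  fixes a c d k :: int
  assumes "c > 0"
  shows "(2 * a * c + d) * k div c = 2 * (a * k) + d * k div c"
proof -
  have "(2 * a * c + d) * k = d * k + c * (2 * (a * k))" by algebra
  then show ?thesis using assms by (simp only: div_mult_self2)
qed

lemma hardy_S_periodic: "c > 0 \<Longrightarrow> hardy_S (2 * a * c + d) c = hardy_S d c"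
  unfolding hardy_S_div by (intro sum.cong refl) (simp add: div_add_period powi_minus_one)

lemma hardy_S4_periodic: "c > 0 \<Longrightarrow> hardy_S4 (2 * a * c + d) c = hardy_S4 d c"
  unfolding hardy_S4_div by (intro sum.cong refl) (simp add: div_add_period powi_minus_one)

lemma hardy_S_sgn_mult:
  assumes "coprime d c" "s \<noteq> 0"
  shows "hardy_S (sgn s * d) c = of_int (sgn s) * hardy_S d c"
  using assms hardy_S_minus[OF assms(1)] by (auto simp: sgn_if)

lemma hardy_S4_sgn_mult:
  assumes "coprime d c" "s \<noteq> 0"
  shows "hardy_S4 (sgn s * d) c = of_int (sgn s) * hardy_S4 d c"
  using assms hardy_S4_minus[OF assms(1)] by (auto simp: sgn_if)

subsection \<open>Reciprocity\<close>

lemma int_le_div_iff: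
  fixes m n q :: int
  assumes "q > 0"
  shows "m \<le> n div q \<longleftrightarrow> m * q \<le> n"
proof -
  have "m \<le> n div q \<longleftrightarrow> of_int m \<le> (of_int n / of_int q :: real)"
    by (simp only: le_floor_iff flip: floor_divide_of_int_eq[where 'a = real])
  also have "\<dots> \<longleftrightarrow> of_int (m * q) \<le> (of_int n :: real)"
    using assms by (simp add: field_simps)
  finally show ?thesis by (simp only: of_int_le_iff)
qed

lemma int_div_less_iff: "q > 0 \<Longrightarrow> n div q < m \<longleftrightarrow> n < m * q" for m n q :: int
  using int_le_div_iff[of q m n] by linarith

lemma sum_int_Suc:
  fixes f :: "int \<Rightarrow> real"
  shows "(\<Sum>j = 1..1 + int n. f j) = f (1 + int n) + (\<Sum>j = 1..int n. f j)"
  by (subst atLeastAtMostPlus1_int_conv) auto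

lemma alternating_sum:
  assumes "n \<ge> 0"
  shows "2 * (\<Sum>j = 1..n. (-1 :: real) powi j) = (-1) powi n - 1"
proof -
  have "2 * (\<Sum>j = 1..int m. (-1 :: real) powi j) = (-1) powi int m - 1" for m
  proof (induction m)
    case (Suc m)
    then show ?case
      by (simp only: of_nat_Suc sum_int_Suc distrib_left) (simp add: powi_minus_one)
  qed simp
  from this[of "nat n"] show ?thesis using assms by simp
qed

lemma weighted_alternating_sum:
  assumes "n \<ge> 0" "even n"
  shows "2 * (\<Sum>j = 1..n. (-1 :: real) powi j * of_int j) = of_int n"
proof -
  \<comment> \<open>A closed form valid for every \<open>m\<close>, odd ones included, lets the
    induction advance by one; \<open>even n\<close> then reduces it to the claim.\<close>
  have "4 * (\<Sum>j = 1..int m. (-1 :: real) powi j * of_int j) = (-1) powi int m * (2 * real m + 1) - 1" for m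
  proof (induction m)
    case (Suc m)
    then show ?case
      by (simp only: of_nat_Suc sum_int_Suc distrib_left) (simp add: powi_minus_one algebra_simps)
  qed simp
  from this[of "nat n"] show ?thesis using assms by (simp add: powi_minus_one)
qed

section \<open>Ranks of the fractions and the reciprocity law\<close>

lemma inj_on_rank:
  fixes c d :: int
  assumes "c > 0" "d > 0"
  shows "inj_on (\<lambda>k. k + d * k div c) A"
proof -
  have "k + d * k div c < l + d * l div c" if "k < l" for k l
    using zdiv_mono1[of "d * k" "d * l" c] assms that by simp
  then have "strict_mono (\<lambda>k. k + d * k div c)" by (simp add: strict_mono_def)
  then show ?thesis using strict_mono_imp_inj_on inj_on_subset by blast
qed

text \<open>If \<open>k/c < j/d\<close>, then \<open>d * k div c < j\<close> and
  \<open>k \<le> c * j div d\<close>; adding these shows that the rank of \<open>k/c\<close> is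
  strictly smaller.\<close>

lemma rank_neq:
  fixes c d :: int
  assumes "c > 0" "d > 0" "d * k < c * j"
  shows "k + d * k div c \<noteq> j + c * j div d"
proof -
  have "d * k div c < j"
    using assms by (simp add: int_div_less_iff mult.commute)
  moreover have "k \<le> c * j div d"
    using assms by (simp add: int_le_div_iff mult.commute)
  ultimately show ?thesis by simp
qed

lemma rank_bounds:
  fixes c d k :: int
  assumes "d > 0" "k \<in> {1..c - 1}"
  shows "k + d * k div c \<in> {1..c + d - 2}"
proof -
  have "d * k div c < d"
    using assms by (simp add: int_div_less_iff)
  moreover have "d * k div c \<ge> 0"
    using assms by (simp add: pos_imp_zdiv_nonneg_iff)
  ultimately show ?thesis using assms by simp
qed

lemma hardy_S_reciprocity:
  assumes "c > 0" "d > 0" "coprime d c" "odd (c + d)"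
  shows "hardy_S d c + hardy_S c d = 1"
proof -
  let ?f = "\<lambda>k. k + d * k div c" and ?g = "\<lambda>j. j + c * j div d"
  let ?A = "?f ` {1..c - 1}" and ?B = "?g ` {1..d - 1}"
  \<comment> \<open>The exponent in the Hardy sum is the rank plus one, whence the minus
    sign.\<close>
  have *: "hardy_S d c = - (\<Sum>m\<in>?A. (-1) powi m)"
    unfolding hardy_S_div sum_negf[symmetric] using assms
    by (subst sum.reindex[OF inj_on_rank]) (auto intro!: sum.cong simp: powi_minus_one split: if_splits)
  have **: "hardy_S c d = - (\<Sum>m\<in>?B. (-1) powi m)"
    unfolding hardy_S_div sum_negf[symmetric] using assms
    by (subst sum.reindex[OF inj_on_rank]) (auto intro!: sum.cong simp: powi_minus_one split: if_splits)
  have "?f k \<noteq> ?g j" if "k \<in> {1..c - 1}" "j \<in> {1..d - 1}" for k j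
  proof -
    have "d * k \<noteq> c * j"
      using not_dvd_mult_of_coprime[OF assms(3) that(1)] by auto
    then show ?thesis
      using rank_neq[of c d k j] rank_neq[of d c j k] assms by fastforce
  qed
  then have disj: "?A \<inter> ?B = {}" by blast
  \<comment> \<open>The two disjoint families supply \<open>(c - 1) + (d - 1)\<close> distinct ranks
    in an interval of exactly that many integers, so every rank occurs.\<close>
  have "?A \<union> ?B = {1..c + d - 2}"
  proof (rule card_subset_eq)
    show "?A \<union> ?B \<subseteq> {1..c + d - 2}"
      using rank_bounds[of d _ c] rank_bounds[of c _ d] assms by (fastforce simp: add.commute)
    show "card (?A \<union> ?B) = card {1..c + d - 2}"
      using assms disj by (simp add: card_Un_disjoint card_image inj_on_rank)
  qed simp
  then have "hardy_S d c + hardy_S c d = - (\<Sum>m = 1..c + d - 2. (-1) powi m)"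
    using disj by (simp add: * ** sum.union_disjoint flip: \<open>?A \<union> ?B = _\<close>)
  also have "\<dots> = 1"
    using alternating_sum[of "c + d - 2"] assms by (simp add: powi_minus_one)
  finally show ?thesis .
qed

text \<open>For odd \<open>d > 0\<close> this is \<open>c/d\<close> plus twice the sum of
  \<open>(-1)^j * frac (c * j / d)\<close> over \<open>0 < j < d\<close>, because the sum of
  \<open>(-1)^j * j\<close> over the same range is \<open>(d - 1) / 2\<close>.\<close>

definition hardy_E :: "int \<Rightarrow> int \<Rightarrow> real" where
  "hardy_E c d = of_int c - 2 * (\<Sum>j = 1..d - 1. (-1) powi j * of_int (c * j div d))"

text \<open>With \<open>m = d * k div c\<close>, write \<open>(-1)^m\<close> as \<open>1\<close>
  plus twice the sum of \<open>(-1)^j\<close> over \<open>1 \<le> j \<le> m\<close>. After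
  exchanging the sums, each \<open>j\<close> is weighted by the number of \<open>k\<close> with
  \<open>c * j \<le> d * k\<close>.\<close>

lemma hardy_S4_eq_E:
  assumes "c > 0" "d > 0" "coprime d c" "odd d"
  shows "hardy_S4 d c = hardy_E c d - 1"
proof -
  \<comment> \<open>Since \<open>d - 1\<close> is even, the signs cancel; at the end this removes
    the constant \<open>c - 1\<close> from the counts.\<close>
  have alt: "(\<Sum>j = 1..d - 1. (-1 :: real) powi j) = 0"
    using alternating_sum[of "d - 1"] assms by (simp add: powi_minus_one)
  have expand: "(-1 :: real) powi (d * k div c)
      = 1 + 2 * (\<Sum>j = 1..d - 1. if c * j \<le> d * k then (-1) powi j else 0)"
    if k: "k \<in> {1..c - 1}" for k
  proof -
    have "d * k div c < d" "d * k div c \<ge> 0"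
      using k assms by (simp_all add: int_div_less_iff pos_imp_zdiv_nonneg_iff)
    moreover have "c * j \<le> d * k \<longleftrightarrow> j \<le> d * k div c" for j
      using assms by (simp add: int_le_div_iff mult.commute)
    \<comment> \<open>As \<open>d * k div c < d\<close>, restricting to \<open>j \<le> d - 1\<close>
      loses nothing.\<close>
    ultimately have "{j \<in> {1..d - 1}. c * j \<le> d * k} = {1..d * k div c}"
      unfolding set_eq_iff mem_Collect_eq atLeastAtMost_iff
      by (metis (no_types) add1_zle_eq le_diff_eq order.strict_trans1)
    then show ?thesis
      using alternating_sum[of "d * k div c"] \<open>d * k div c \<ge> 0\<close>
      by (simp flip: sum.inter_filter)
  qed
  have count: "(\<Sum>k = 1..c - 1. if c * j \<le> d * k then (-1 :: real) powi j else 0)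
      = (-1) powi j * (of_int (c - 1) - of_int (c * j div d))"
    if j: "j \<in> {1..d - 1}" for j
  proof -
    have lt: "c * j div d < c" and ge: "c * j div d \<ge> 0"
      using j assms by (simp_all add: int_div_less_iff pos_imp_zdiv_nonneg_iff)
    have "c * j \<le> d * k \<longleftrightarrow> c * j div d < k" for k
    proof -
      \<comment> \<open>Coprimality excludes equality, so the admissible \<open>k\<close> are
        exactly those beyond the floor \<open>c * j div d\<close>.\<close>
      have "c * j \<noteq> d * k"
        using not_dvd_mult_of_coprime[OF _ j, of c] assms(3) by (auto simp: coprime_commute)
      moreover have "c * j div d < k \<longleftrightarrow> c * j < d * k"
        using assms by (simp add: int_div_less_iff mult.commute)
      ultimately show ?thesis by linarith
    qed
    moreover have "{k \<in> {1..M}. N < k} = {N + 1..M}" if "N \<ge> 0" for N M :: int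
      using that by auto
    ultimately have "{k \<in> {1..c - 1}. c * j \<le> d * k} = {c * j div d + 1..c - 1}"
      using ge by presburger
    then show ?thesis using lt
      by (subst sum.inter_filter[symmetric]) (simp_all add: algebra_simps)
  qed
  have "hardy_S4 d c = of_int (c - 1)
      + 2 * (\<Sum>j = 1..d - 1. \<Sum>k = 1..c - 1. if c * j \<le> d * k then (-1) powi j else 0)"
    using assms unfolding hardy_S4_div
    by (subst sum.swap) (simp add: expand sum.distrib sum_distrib_left)
  also have "\<dots> = of_int (c - 1) + 2 * (\<Sum>j = 1..d - 1. (-1) powi j * of_int (c - 1)
      - (-1) powi j * of_int (c * j div d))"
    by (simp only: sum.cong[OF refl count] right_diff_distrib)
  also have "\<dots> = hardy_E c d - 1"
    using alt by (simp add: hardy_E_def sum_subtractf flip: sum_distrib_right)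
  finally show ?thesis .
qed

text \<open>The leading term grows by \<open>a * d\<close>, the floors by \<open>a * j\<close>;
  twice the alternating sum of the latter takes back \<open>a * (d - 1)\<close>, and
  \<open>a\<close> remains.\<close>

lemma hardy_E_add_mult:
  assumes "d > 0" "odd d"
  shows "hardy_E (c + a * d) d = hardy_E c d + of_int a"
proof -
  have "(c + a * d) * j div d = c * j div d + a * j" for j
  proof -
    have "(c + a * d) * j = c * j + d * (a * j)" by algebra
    then show ?thesis using assms by (simp only: div_mult_self2)
  qed
  then have "hardy_E (c + a * d) d = hardy_E c d + of_int (a * d)
      - of_int a * (2 * (\<Sum>j = 1..d - 1. (-1) powi j * of_int j))"
    by (simp add: hardy_E_def algebra_simps sum.distrib sum_distrib_left)
  also have "2 * (\<Sum>j = 1..d - 1. (-1 :: real) powi j * of_int j) = of_int (d - 1)"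
    by (rule weighted_alternating_sum) (use assms in auto)
  finally show ?thesis by (simp add: algebra_simps)
qed

text \<open>Each floor \<open>m\<close> becomes \<open>- m - 1\<close>, and the extra terms
  \<open>- (-1)^j\<close> cancel because \<open>d - 1\<close> is even.\<close>

lemma hardy_E_minus:
  assumes "d > 0" "odd d" "coprime c d"
  shows "hardy_E (- c) d = - hardy_E c d"
proof -
  have "(\<Sum>j = 1..d - 1. (-1 :: real) powi j * of_int ((- c) * j div d))
      = (\<Sum>j = 1..d - 1. - ((-1) powi j * of_int (c * j div d)) - (-1) powi j)"
    by (intro sum.cong refl, subst minus_mult_div[OF assms(3)]) (auto simp: algebra_simps)
  also have "\<dots> = - (\<Sum>j = 1..d - 1. (-1) powi j * of_int (c * j div d))"
    using alternating_sum[of "d - 1"] assms by (simp add: sum_subtractf sum_negf powi_minus_one)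
  finally show ?thesis by (simp add: hardy_E_def)
qed

lemma hardy_E_sgn_mult:
  assumes "d > 0" "odd d" "coprime c d" "s \<noteq> 0"
  shows "hardy_E (sgn s * c) d = of_int (sgn s) * hardy_E c d"
  using assms hardy_E_minus[OF assms(1-3)] by (auto simp: sgn_if)

subsection \<open>Removing partial quotients\<close>

text \<open>Recovers \<open>d\<close> and \<open>c\<close> themselves from the real value of a
  continued fraction, once that value is written in lowest terms.\<close>

lemma fraction_eqD:
  fixes d c p q :: int
  assumes "of_int d / of_int c = (of_int p / of_int q :: real)"
    and "c > 0" "q > 0" "coprime d c" "coprime p q"
  shows "d = p" "c = q"
proof -
  have "of_int (d * q) = (of_int (p * c) :: real)"
    using assms by (simp add: field_simps)
  then have eq: "d * q = p * c" by (simp only: of_int_eq_iff)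
  then have "c dvd d * q" "q dvd p * c" by (metis dvd_triv_right)+
  then have "c dvd q" "q dvd c"
    using assms by (simp_all add: coprime_commute coprime_dvd_mult_right_iff)
  then show "c = q" using assms zdvd_antisym_nonneg by simp
  then show "d = p" using eq assms by simp
qed

text \<open>Here \<open>p / q\<close> is the value of the tail. Lowest terms give
  \<open>c = \<bar>p\<bar>\<close> and \<open>d = 2 * b * \<bar>p\<bar> - sgn p * q\<close>.
  Periodicity and oddness lead to \<open>hardy_S q \<bar>p\<bar>\<close>, reciprocity to
  \<open>1 - hardy_S \<bar>p\<bar> q\<close>. The parity conclusion allows the step to be
  repeated.\<close>

lemma hardy_S_step:
  fixes d c p q b :: int
  assumes "c > 0" "coprime d c" "odd (c + d)" and "q > 0" "coprime p q" "p \<noteq> 0"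
    and "of_int d / of_int c = (of_int (2 * b) - 1 / (of_int p / of_int q) :: real)"
  shows "hardy_S d c = hardy_S p q - of_int (sgn p)" "odd (q + p)"
proof -
  define r where "r = \<bar>p\<bar>"
  have p: "p = sgn p * r" "r > 0" using assms(6) by (simp_all add: r_def mult_sgn_abs)
  have qr: "coprime q r" using assms by (simp add: r_def coprime_commute)
  have "of_int d / of_int c = (of_int (2 * b * r - sgn p * q) / of_int r :: real)"
    using assms(6,7) unfolding r_def by (cases "p > 0") (auto simp: field_simps)
  moreover have "coprime (2 * b * r - sgn p * q) r"
  proof -
    have "coprime (- (sgn p * q)) r" using qr assms(6) by (auto simp: sgn_if)
    then show ?thesis
      by (metis coprime_iff_gcd_eq_1 gcd_add_mult add.commute mult.commute gcd.commute diff_conv_add_uminus)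
  qed
  ultimately have d: "d = 2 * b * r + sgn (- p) * q" and c: "c = r"
    using fraction_eqD[of d c "2 * b * r - sgn p * q" r] assms(1,2) p(2) by simp_all
  have "odd (r + (2 * b * r + sgn (- p) * q))" using assms(3) c d by simp
  then have odd: "odd (r + q)" using assms(6) by (auto simp: sgn_if split: if_splits)
  then show "odd (q + p)" by (simp add: r_def)
  have "hardy_S d c = - of_int (sgn p) * hardy_S q r"
    unfolding d c hardy_S_periodic[OF p(2)]
    using hardy_S_sgn_mult[OF qr, of "- p"] assms(6) by (simp add: sgn_minus)
  also have "hardy_S q r = 1 - hardy_S r q"
    using hardy_S_reciprocity[OF p(2) assms(4) qr odd] by simp
  also have "hardy_S r q = of_int (sgn p) * hardy_S p q"
    using hardy_S_sgn_mult[OF assms(5,6)] by (simp add: r_def mult.commute abs_sgn)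
  finally show "hardy_S d c = hardy_S p q - of_int (sgn p)"
    using assms(6) by (simp add: algebra_simps sgn_if)
qed

text \<open>Here \<open>p / q\<close> is the tail after the quotients \<open>2 * b\<close> and
  \<open>a\<close>, and the hypothesis \<open>sgn\<close> says that \<open>a + q/p\<close> has the
  sign of \<open>a\<close>. Up to signs, the sum passes through
  \<open>hardy_E (a * p + q) \<bar>p\<bar>\<close> and \<open>hardy_E q \<bar>p\<bar>\<close> to
  \<open>hardy_S4 p q\<close>.\<close>

lemma hardy_S4_step:
  fixes d c p q a b :: int
  assumes "c > 0" "coprime d c" "odd d" and "q > 0" "coprime p q" "p \<noteq> 0" "a \<noteq> 0"
    and sgn: "sgn (a * p + q) = sgn (a * p)"
    and eq: "of_int d / of_int c = (of_int (2 * b) + 1 / (of_int a + 1 / (of_int p / of_int q)) :: real)"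
  shows "hardy_S4 d c = hardy_S4 p q + of_int a - of_int (sgn a) + of_int (sgn p)" "odd p"
proof -
  define P where "P = \<bar>p\<bar>"
  define x where "x = a * p + q"
  define r where "r = \<bar>x\<bar>"
  have x: "x \<noteq> 0" "sgn x = sgn a * sgn p" using sgn assms(6,7) by (auto simp: x_def sgn_mult sgn_0_0)
  have r: "x = sgn x * r" "r > 0" using x(1) by (simp_all add: r_def mult_sgn_abs)
  have P: "P > 0" "p = sgn p * P" using assms(6) by (simp_all add: P_def mult_sgn_abs)
  have Pq: "coprime q P" using assms(5) by (simp add: P_def coprime_commute)
  have "gcd p (a * p + q) = gcd p q" by (metis gcd_add_mult)
  then have "coprime p x" using assms(5) by (simp add: x_def coprime_iff_gcd_eq_1)
  then have px: "coprime p r" "coprime P r" by (simp_all add: r_def P_def)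
  have "of_int d / of_int c = (of_int (2 * b) + of_int p / of_int x :: real)"
    using eq assms(4,6) by (simp add: x_def field_simps)
  also have "\<dots> = of_int (2 * b * r + sgn x * p) / of_int r"
    using x(1) unfolding r_def by (cases "x > 0") (auto simp: field_simps)
  finally have "of_int d / of_int c = (of_int (2 * b * r + sgn x * p) / of_int r :: real)" .
  moreover have "coprime (2 * b * r + sgn x * p) r"
  proof -
    have "coprime (sgn x * p) r" using px x(1) by (auto simp: sgn_if)
    then show ?thesis
      by (metis coprime_iff_gcd_eq_1 gcd_add_mult gcd.commute)
  qed
  ultimately have d: "d = 2 * b * r + sgn x * p" and c: "c = r"
    using fraction_eqD[of d c "2 * b * r + sgn x * p" r] assms(1,2) r(2) by simp_all
  show "odd p" using assms(3) by (simp add: d)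
  then have "odd P" by (simp add: P_def)
  have "hardy_S4 d c = of_int (sgn x * sgn p) * hardy_S4 P r"
    using hardy_S4_sgn_mult[OF px(1) x(1)] hardy_S4_sgn_mult[OF px(2) assms(6)] r(2)
    by (simp add: d c hardy_S4_periodic flip: P(2))
  also have "hardy_S4 P r = hardy_E r P - 1"
    by (rule hardy_S4_eq_E) (use r P px \<open>odd P\<close> in auto)
  also have "hardy_E r P = of_int (sgn x) * hardy_E x P"
  proof -
    have "coprime x P" using \<open>coprime p x\<close> by (simp add: P_def coprime_commute)
    from hardy_E_sgn_mult[OF P(1) \<open>odd P\<close> this x(1)] show ?thesis
      by (simp add: r_def abs_sgn mult.commute)
  qed
  \<comment> \<open>The quotient \<open>a\<close> disappears here:
    \<open>a * p = (a * sgn p) * P\<close> is a multiple of the modulus \<open>P\<close>.\<close>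
  also have "hardy_E x P = hardy_E q P + of_int (a * sgn p)"
    using hardy_E_add_mult[OF P(1) \<open>odd P\<close>, of q "a * sgn p"] P(2)
    by (simp add: x_def mult.assoc add.commute)
  also have "hardy_E q P = of_int (sgn p) * hardy_S4 p q + 1"
  proof -
    have "hardy_S4 P q = of_int (sgn p) * hardy_S4 p q"
      using hardy_S4_sgn_mult[OF assms(5,6)] by (simp add: P_def abs_sgn mult.commute)
    then show ?thesis
      using hardy_S4_eq_E[of q P] P Pq assms(4) \<open>odd P\<close> by (simp add: coprime_commute)
  qed
  finally show "hardy_S4 d c = hardy_S4 p q + of_int a - of_int (sgn a) + of_int (sgn p)"
    unfolding x(2) using assms(6,7) by (auto simp: sgn_if)
qed

subsection \<open>Continued fractions\<close>

lemma cf_minus_Rats: "cf_minus bs \<in> \<rat>"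
  by (induction bs rule: cf_minus.induct) auto

lemma cf_plus_Rats: "cf_plus bs \<in> \<rat>"
  by (induction bs rule: cf_plus.induct) auto

lemma cf_minus_map_upt_Suc:
  "cf_minus (map f [0..<Suc (Suc n)]) = of_int (f 0) - 1 / cf_minus (map (\<lambda>k. f (Suc k)) [0..<Suc n])"
  by (simp add: map_upt_Suc del: upt_Suc)

lemma cf_plus_map_upt_Suc:
  "cf_plus (map f [0..<Suc (Suc n)]) = of_int (f 0) + 1 / cf_plus (map (\<lambda>k. f (Suc k)) [0..<Suc n])"
  by (simp add: map_upt_Suc del: upt_Suc)

text \<open>A perturbation of size at most 1 cannot reverse the sign of an integer of size at least
  2 and leaves a value of size at least 1, so the bound propagates outwards through a continued
  fraction.\<close>

lemma sgn_add_inverse: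
  fixes y :: real and b :: int
  assumes "\<bar>y\<bar> \<ge> 1" "\<bar>b\<bar> \<ge> 2"
  shows "sgn (of_int b + 1 / y) = of_int (sgn b)" "\<bar>of_int b + 1 / y\<bar> \<ge> 1"
proof -
  define z where "z = 1 / y"
  have "\<bar>z\<bar> \<le> 1" using assms(1) by (simp add: z_def field_simps)
  moreover have "(of_int b :: real) \<ge> 2 \<or> (of_int b :: real) \<le> -2" using assms(2) by linarith
  ultimately show "sgn (of_int b + 1 / y) = of_int (sgn b)" "\<bar>of_int b + 1 / y\<bar> \<ge> 1"
    unfolding z_def[symmetric] by (auto simp: sgn_if)
qed

text \<open>Meant for tails, whose first entry is also nonzero. Sign and bound share one induction,
  since the sign at each stage depends on the bound for the next tail.\<close>

lemma cf_minus_even_sgn: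
  assumes "\<forall>k\<in>{0..n}. e k \<noteq> 0"
  shows "sgn (cf_minus (map (\<lambda>k. 2 * e k) [0..<n + 1])) = of_int (sgn (e 0))"
    and "\<bar>cf_minus (map (\<lambda>k. 2 * e k) [0..<n + 1])\<bar> \<ge> 1"
proof -
  have "sgn (cf_minus (map (\<lambda>k. 2 * e k) [0..<n + 1])) = of_int (sgn (e 0))
    \<and> \<bar>cf_minus (map (\<lambda>k. 2 * e k) [0..<n + 1])\<bar> \<ge> 1"
    using assms
  proof (induction n arbitrary: e)
    case 0
    then show ?case by (auto simp: sgn_if)
  next
    case (Suc n)
    let ?y = "cf_minus (map (\<lambda>k. 2 * e (Suc k)) [0..<n + 1])"
    have "\<bar>- ?y\<bar> \<ge> 1" using Suc.IH[of "\<lambda>k. e (Suc k)"] Suc.prems by auto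
    moreover have "e 0 \<noteq> 0" using Suc.prems by simp
    then have "\<bar>2 * e 0\<bar> \<ge> 2" by linarith
    ultimately show ?case
      using sgn_add_inverse[of "- ?y" "2 * e 0"]
      by (simp add: cf_minus_map_upt_Suc sgn_mult del: upt_Suc)
  qed
  then show "sgn (cf_minus (map (\<lambda>k. 2 * e k) [0..<n + 1])) = of_int (sgn (e 0))"
    and "\<bar>cf_minus (map (\<lambda>k. 2 * e k) [0..<n + 1])\<bar> \<ge> 1" by auto
qed

lemma hardy_S_cf_minus:
  fixes d c :: int and e :: "nat \<Rightarrow> int"
  assumes "c > 0" "coprime d c" "odd (c + d)" "\<forall>k\<in>{1..n}. e k \<noteq> 0"
    and "of_int d / of_int c = cf_minus (map (\<lambda>k. 2 * e k) [0..<n + 1])"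
  shows "hardy_S d c = - (\<Sum>k = 1..n. of_int (sgn (e k)))"
  using assms
proof (induction n arbitrary: d c e)
  case 0
  \<comment> \<open>An integer value forces \<open>c = 1\<close>, so both sides are empty
    sums.\<close>
  then have "d = 2 * e 0 \<and> c = 1"
    using fraction_eqD[of d c "2 * e 0" 1] by simp
  then show ?case by (simp add: hardy_S_def)
next
  case (Suc n)
  let ?y = "cf_minus (map (\<lambda>k. 2 * e (Suc k)) [0..<n + 1])"
  \<comment> \<open>With \<open>q > 0\<close> the sign of the tail is that of \<open>p\<close>, so
    the correction \<open>sgn p\<close> in \<open>hardy_S_step\<close> becomes
    \<open>sgn (e 1)\<close>.\<close>
  obtain p q where pq: "q > 0" "coprime p q" "?y = of_int p / of_int q"
    using cf_minus_Rats by (rule Rats_cases')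
  have "\<forall>k\<in>{0..n}. e (Suc k) \<noteq> 0" using Suc.prems(4) by simp
  from cf_minus_even_sgn[OF this] have "sgn p = sgn (e 1)" and "p \<noteq> 0"
    using pq by (auto simp: sgn_if zero_less_divide_iff divide_less_0_iff split: if_splits)
  have "of_int d / of_int c = of_int (2 * e 0) - 1 / (of_int p / of_int q :: real)"
    using Suc.prems(5) pq(3) by (simp add: cf_minus_map_upt_Suc del: upt_Suc)
  from hardy_S_step[OF Suc.prems(1-3) pq(1,2) \<open>p \<noteq> 0\<close> this]
  have "hardy_S d c = hardy_S p q - of_int (sgn p)" "odd (q + p)" .
  moreover have "hardy_S p q = - (\<Sum>k = 1..n. of_int (sgn (e (Suc k))))"
    by (rule Suc.IH) (use pq \<open>odd (q + p)\<close> Suc.prems(4) in auto)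
  moreover have "(\<Sum>k = 1..Suc n. of_int (sgn (e k)) :: real)
      = of_int (sgn (e 1)) + (\<Sum>k = 1..n. of_int (sgn (e (Suc k))))"
    by (subst sum.atLeast_Suc_atMost) (simp_all add: sum.shift_bounds_cl_Suc_ivl del: sum.cl_ivl_Suc)
  ultimately show ?case using \<open>sgn p = sgn (e 1)\<close> by simp
qed

text \<open>Meant for tails starting at an even index. Doubled entries and inner odd-indexed ones
  have size at least 2; the last entry, being the innermost value, needs only size at least 1. Hence
  the induction removes two entries at a time.\<close>

lemma cf_plus_alternating_sgn:
  assumes "odd n" "\<forall>k\<in>{0..n}. a k \<noteq> 0" "\<forall>k\<in>{0..n}. odd k \<and> k + 2 \<le> n \<longrightarrow> \<bar>a k\<bar> > 1"
  shows "sgn (cf_plus (map (\<lambda>k. if even k then 2 * a k else a k) [0..<n + 1])) = of_int (sgn (a 0))"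
    and "\<bar>cf_plus (map (\<lambda>k. if even k then 2 * a k else a k) [0..<n + 1])\<bar> \<ge> 1"
proof -
  obtain m where n: "n = Suc (2 * m)" using assms(1) by (auto elim: oddE)
  define y where "y a m = cf_plus (map (\<lambda>k. if even k then 2 * a k else a k) [0..<Suc (2 * m) + 1])"
    for a :: "nat \<Rightarrow> int" and m
  have two: "\<bar>2 * i\<bar> \<ge> 2" if "i \<noteq> 0" for i :: int using that by linarith
  have "sgn (y a m) = of_int (sgn (a 0)) \<and> \<bar>y a m\<bar> \<ge> 1"
    using assms(2,3) unfolding n
  proof (induction m arbitrary: a)
    case 0
    then have a0: "a 0 \<noteq> 0" and "a 1 \<noteq> 0" by simp_all
    then have "\<bar>of_int (a 1) :: real\<bar> \<ge> 1" by linarith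
    then show ?case
      using sgn_add_inverse[OF _ two[OF a0], of "of_int (a 1)"] by (simp add: y_def sgn_mult)
  next
    case (Suc m)
    have "\<forall>k\<in>{0..Suc (2 * m)}. a (k + 2) \<noteq> 0" using Suc.prems(1) by simp
    moreover have "\<forall>k\<in>{0..Suc (2 * m)}. odd k \<and> k + 2 \<le> Suc (2 * m) \<longrightarrow> \<bar>a (k + 2)\<bar> > 1"
      using Suc.prems(2) by simp
    ultimately have "\<bar>y (\<lambda>k. a (k + 2)) m\<bar> \<ge> 1" using Suc.IH by simp
    moreover have "\<bar>a 1\<bar> \<ge> 2" using Suc.prems(2)[rule_format, of 1] by simp
    ultimately have "\<bar>of_int (a 1) + 1 / y (\<lambda>k. a (k + 2)) m\<bar> \<ge> 1" by (rule sgn_add_inverse)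
    moreover have "a 0 \<noteq> 0" using Suc.prems(1) by simp
    ultimately show ?case
      using sgn_add_inverse[OF _ two, of _ "a 0"]
      by (simp add: y_def cf_plus_map_upt_Suc sgn_mult del: upt_Suc)
  qed
  then show "sgn (cf_plus (map (\<lambda>k. if even k then 2 * a k else a k) [0..<n + 1])) = of_int (sgn (a 0))"
    and "\<bar>cf_plus (map (\<lambda>k. if even k then 2 * a k else a k) [0..<n + 1])\<bar> \<ge> 1"
    by (auto simp: y_def n simp del: upt_Suc)
qed

section \<open>Evaluation of \<open>hardy_S4\<close> along a continued fraction\<close>

lemma hardy_S4_sgn:
  assumes "a \<noteq> 0"
  shows "hardy_S4 (sgn a) \<bar>a\<bar> = of_int a - of_int (sgn a)"
proof -
  have "hardy_S4 1 \<bar>a\<bar> = of_int \<bar>a\<bar> - 1"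
    using assms by (simp add: hardy_S4_div)
  then show ?thesis
    using hardy_S4_sgn_mult[of 1 "\<bar>a\<bar>" a] assms by (auto simp: sgn_if)
qed

lemma sum_shift_two:
  fixes f :: "nat \<Rightarrow> real"
  shows "(\<Sum>k = 1..n + 2. f k) = f 1 + f 2 + (\<Sum>k = 1..n. f (k + 2))"
  by (induction n) (simp_all add: numeral_2_eq_2)

lemma hardy_S4_cf_plus:
  fixes d c :: int and a :: "nat \<Rightarrow> int"
  assumes "c > 0" "coprime d c" "odd d" "odd n" "\<forall>k\<in>{1..n}. a k \<noteq> 0"
    and "\<forall>k\<in>{1..n}. odd k \<and> k + 2 \<le> n \<longrightarrow> \<bar>a k\<bar> > 1"
    and "of_int d / of_int c = cf_plus (map (\<lambda>k. if even k then 2 * a k else a k) [0..<n + 1])"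
  shows "hardy_S4 d c = (\<Sum>k = 1..n. (if odd k then of_int (a k) else 0) + (-1) ^ k * of_int (sgn (a k)))"
proof -
  obtain m where n: "n = Suc (2 * m)" using assms(4) by (auto elim: oddE)
  show ?thesis
    using assms(1-3,5-7) unfolding n
  proof (induction m arbitrary: d c a)
    case 0
    \<comment> \<open>The numerator of \<open>2 * a 0 + 1 / a 1\<close> over the positive
      denominator \<open>\<bar>a 1\<bar>\<close>.\<close>
    let ?b = "2 * a 0 * \<bar>a 1\<bar> + sgn (a 1)"
    have a1: "a 1 \<noteq> 0" using 0 by simp
    then have "of_int d / of_int c = (of_int ?b / of_int \<bar>a 1\<bar> :: real)"
      using 0 by (cases "a 1 > 0") (auto simp: field_simps)
    moreover have "coprime ?b \<bar>a 1\<bar>"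
      using a1 by (auto simp: sgn_if coprime_iff_gcd_eq_1 gcd.commute gcd_add_mult)
    ultimately have "d = ?b" "c = \<bar>a 1\<bar>"
      using fraction_eqD[of d c ?b "\<bar>a 1\<bar>"] 0 a1 by auto
    then show ?case
      using a1 hardy_S4_periodic[of "\<bar>a 1\<bar>" "a 0" "sgn (a 1)"] hardy_S4_sgn[OF a1] by simp
  next
    case (Suc m)
    \<comment> \<open>Dropping two entries preserves the parity of indices, so the tail has the same
      shape.\<close>
    let ?b = "\<lambda>k. a (k + 2)"
    let ?y = "cf_plus (map (\<lambda>k. if even k then 2 * ?b k else ?b k) [0..<Suc (2 * m) + 1])"
    obtain p q where pq: "q > 0" "coprime p q" "?y = of_int p / of_int q"
      using cf_plus_Rats by (rule Rats_cases')
    have b: "\<forall>k\<in>{0..Suc (2 * m)}. ?b k \<noteq> 0"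
      "\<forall>k\<in>{0..Suc (2 * m)}. odd k \<and> k + 2 \<le> Suc (2 * m) \<longrightarrow> \<bar>?b k\<bar> > 1"
      using Suc.prems(4,5) by simp_all
    have y: "sgn ?y = of_int (sgn (a 2))" "\<bar>?y\<bar> \<ge> 1"
      using cf_plus_alternating_sgn[of "Suc (2 * m)" ?b, OF _ b, unfolded add_0]
      by (simp_all del: upt_Suc)
    have a2: "a 2 \<noteq> 0" using b(1)[rule_format, of 0] by (simp add: numeral_2_eq_2)
    with y pq have p: "sgn p = sgn (a 2)" "p \<noteq> 0"
      by (auto simp: sgn_if zero_less_divide_iff divide_less_0_iff split: if_splits)
    have a1: "\<bar>a 1\<bar> \<ge> 2" using Suc.prems(5)[rule_format, of 1] by simp
    \<comment> \<open>Clearing the denominator \<open>p\<close> turns this into the sign hypothesis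
      of \<open>hardy_S4_step\<close>.\<close>
    have "sgn (of_int (a 1) + 1 / ?y) = of_int (sgn (a 1))"
      by (rule sgn_add_inverse) (use y a1 in auto)
    moreover define x where "x = a 1 * p + q"
    moreover have "of_int (a 1) + 1 / ?y = of_int x / of_int p"
      unfolding pq(3) x_def using p(2) pq(1) by (simp add: field_simps)
    ultimately have "sgn (of_int x / of_int p :: real) = of_int (sgn (a 1))" by (simp only:)
    then have "sgn x = sgn (a 1 * p)"
      using p(2) by (auto simp: sgn_if zero_less_divide_iff zero_less_mult_iff split: if_splits)
    then have "sgn (a 1 * p + q) = sgn (a 1 * p)" by (simp only: x_def)
    moreover have "of_int d / of_int c
        = of_int (2 * a 0) + 1 / (of_int (a 1) + 1 / (of_int p / of_int q :: real))"
      using Suc.prems(6) by (simp add: cf_plus_map_upt_Suc cong: if_cong flip: pq(3) del: upt_Suc)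
    moreover have "a 1 \<noteq> 0" using a1 by auto
    ultimately have "hardy_S4 d c = hardy_S4 p q + of_int (a 1) - of_int (sgn (a 1)) + of_int (sgn p)"
      and "odd p"
      using hardy_S4_step[OF Suc.prems(1-3) pq(1,2) p(2), of "a 1" "a 0"] by blast+
    moreover have "hardy_S4 p q = (\<Sum>k = 1..Suc (2 * m).
        (if odd k then of_int (?b k) else 0) + (-1) ^ k * of_int (sgn (?b k)))"
      by (rule Suc.IH) (use pq \<open>odd p\<close> b in auto)
    \<comment> \<open>The added terms \<open>a 1 - sgn (a 1) + sgn (a 2)\<close> are the summands
      for \<open>k = 1\<close> and \<open>k = 2\<close>.\<close>
    ultimately show ?case
      using sum_shift_two[of _ "Suc (2 * m)"] by (simp add: p cong: if_cong del: sum.cl_ivl_Suc)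
  qed
qed

theorem theorem1p1:
  fixes d c :: int
  assumes "c > 0" and "coprime d c"
  shows
    "(odd (c + d) \<longrightarrow>
       (\<forall>(n::nat) (e::nat \<Rightarrow> int).
          (\<forall>k\<in>{1..n}. e k \<noteq> 0) \<longrightarrow>
          of_int d / of_int c = cf_minus (map (\<lambda>k. 2 * e k) [0..<n + 1]) \<longrightarrow>
          hardy_S d c = - (\<Sum>k = 1..n. of_int (sgn (e k)))))
     \<and>
     (odd d \<longrightarrow>
       (\<forall>(n::nat) (a::nat \<Rightarrow> int).
          odd n \<longrightarrow>
          (\<forall>k\<in>{1..n}. a k \<noteq> 0) \<longrightarrow>
          (\<forall>k\<in>{1..n}. odd k \<and> k + 2 \<le> n \<longrightarrow> \<bar>a k\<bar> > 1) \<longrightarrow>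
          of_int d / of_int c = cf_plus (map (\<lambda>k. if even k then 2 * a k else a k) [0..<n + 1]) \<longrightarrow>
          hardy_S4 d c =
            of_int (\<Sum>k | k \<in> {1..n} \<and> odd k. a k) + (\<Sum>k = 1..n. (-1) ^ k * of_int (sgn (a k)))))"
proof (intro conjI impI allI)
  fix n :: nat and e :: "nat \<Rightarrow> int"
  assume "odd (c + d)" "\<forall>k\<in>{1..n}. e k \<noteq> 0"
    "of_int d / of_int c = cf_minus (map (\<lambda>k. 2 * e k) [0..<n + 1])"
  then show "hardy_S d c = - (\<Sum>k = 1..n. of_int (sgn (e k)))"
    by (rule hardy_S_cf_minus[OF assms])
next
  fix n :: nat and a :: "nat \<Rightarrow> int"
  assume *: "odd d" "odd n" "\<forall>k\<in>{1..n}. a k \<noteq> 0"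
    "\<forall>k\<in>{1..n}. odd k \<and> k + 2 \<le> n \<longrightarrow> \<bar>a k\<bar> > 1"
    "of_int d / of_int c = cf_plus (map (\<lambda>k. if even k then 2 * a k else a k) [0..<n + 1])"
  show "hardy_S4 d c =
      of_int (\<Sum>k | k \<in> {1..n} \<and> odd k. a k) + (\<Sum>k = 1..n. (-1) ^ k * of_int (sgn (a k)))"
    unfolding hardy_S4_cf_plus[OF assms *] sum.distrib
    by (simp add: sum.inter_filter if_distrib cong: if_cong flip: atLeastAtMost_iff)
qed

end
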